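(* Let $\mathcal X$ be a nonempty set of variables, let $\Theta\subseteq\mathsf{FORM}_{\mathcal X}$ be an infinite set of formulas, and let $\phi\in\mathsf{FORM}_{\mathcal X}$. Then $\Theta\models_\Diamond\phi$ iff $\{\theta_1,\dots,\theta_k\}\models_\Diamond\phi$ for some $\theta_1,\dots,\theta_k\in\Theta$.
   Context: Let $\mathfrak Z=\{0,1/2,1\}$, with the following binary operations. - $x\wedge y=\min(x,y)$. - $x\sqcup y=x$ if $x=y$, and $x\sqcup y=1/2$ otherwise. - $\partial(x,y)=1/2$ if $y=1/2$. If $y\in\{0,1\}$, then $\partial(x,y)=y$ when $x=y$, and $\partial(x,y)=1-y$ when $x\ne y$. For a nonempty (possibly uncountable) set $\mathcal X$ of variables, $\mathsf{FORM}_{\mathcal X}$ is the set of formulas built from the variables in $\mathcal X$ and the constant symbols $0$ and $1/2$ by finitely many applications of the binary connectives $\sqcup,\partial,\wedge$. Each $v\in\mathfrak Z^{\mathcal X}$ (a valuation) extends uniquely to formulas: constants take their own values, and connectives are interpreted by the operations above. Write $\hat\phi(v)$ for the value of $\phi$ under $v$. A set $\Theta$ of formulas is incompatible if there exist $v\in\mathfrak Z^{\mathcal X}$ and $\theta_1,\theta_2\in\Theta$ with $\{\hat\theta_1(v),\hat\theta_2(v)\}=\{0,1\}$; otherwise it is compatible. $\Theta\models_\Diamond\phi$ is defined as follows. - If $\Theta$ is incompatible, then $\Theta\models_\Diamond\phi$ for every $\phi$. - If $\Theta$ is compatible, then $\Theta\models_\Diamond\phi$ iff for every $v\in\mathfrak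 Z^{\mathcal X}$ there is $\theta\in\Theta\cup\{1/2\}$ with $\hat\theta(v)\sqcup\hat\phi(v)=\hat\phi(v)$. *)

theory Defs
  imports Complex_Main "HOL-Library.FuncSet"
begin

definition ZZ :: "real set" where
  "ZZ = {0, 1/2, 1}"

text \<open>
  The connectives are written as total functions on the reals; only their restrictions to
  \<^const>\<open>ZZ\<close>, which is closed under them, are meaningful.  The conjunction is \<^const>\<open>min\<close>.
\<close>

definition zjoin :: "real \<Rightarrow> real \<Rightarrow> real" where
  "zjoin x y = (if x = y then x else 1/2)"

definition zpartial :: "real \<Rightarrow> real \<Rightarrow> real" where
  "zpartial x y = (if y = 1/2 then 1/2 else if x = y then y else 1 - y)"

datatype (vars: 'x) form =
    Var 'x
  | Zero
  | Half
  | Join "'x form" "'x form"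
  | Partial "'x form" "'x form"
  | Conj "'x form" "'x form"

definition FORM :: "'x set \<Rightarrow> 'x form set" where
  "FORM X = {\<phi>. vars \<phi> \<subseteq> X}"

definition valuations :: "'x set \<Rightarrow> ('x \<Rightarrow> real) set" where
  "valuations X = X \<rightarrow>\<^sub>E ZZ"

primrec val :: "'x form \<Rightarrow> ('x \<Rightarrow> real) \<Rightarrow> real" where
  "val (Var x) v = v x"
| "val Zero v = 0"
| "val Half v = 1/2"
| "val (Join \<phi> \<psi>) v = zjoin (val \<phi> v) (val \<psi> v)"
| "val (Partial \<phi> \<psi>) v = zpartial (val \<phi> v) (val \<psi> v)"
| "val (Conj \<phi> \<psi>) v = min (val \<phi> v) (val \<psi> v)"

definition incompatible :: "'x set \<Rightarrow> 'x form set \<Rightarrow> bool" where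
  "incompatible X \<Theta> \<longleftrightarrow>
     (\<exists>v\<in>valuations X. \<exists>\<theta>\<^sub>1\<in>\<Theta>. \<exists>\<theta>\<^sub>2\<in>\<Theta>. {val \<theta>\<^sub>1 v, val \<theta>\<^sub>2 v} = {0, 1})"

definition entails :: "'x set \<Rightarrow> 'x form set \<Rightarrow> 'x form \<Rightarrow> bool" where
  "entails X \<Theta> \<phi> \<longleftrightarrow>
     incompatible X \<Theta> \<or>
     (\<forall>v\<in>valuations X. \<exists>\<theta>\<in>\<Theta> \<union> {Half}. zjoin (val \<theta> v) (val \<phi> v) = val \<phi> v)"

end

theory Submission
  imports Defs "HOL-Analysis.Function_Topology" "HOL-Analysis.Product_Topology"
begin

text \<open>
  Give \<^const>\<open>ZZ\<close> the discrete topology. The space of valuations is then compact by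
  Tychonoff's theorem, and formulas are continuous since they are built by finitely many
  operations from coordinates. The valuations at which a given \<open>\<theta>\<close> witnesses the entailment of
  \<open>\<phi>\<close> therefore form an open set, and finitely many of these sets already cover the space.
\<close>

definition valuation_topology :: "'x set \<Rightarrow> ('x \<Rightarrow> real) topology" where
  "valuation_topology X = product_topology (\<lambda>_. discrete_topology ZZ) X"

lemma topspace_valuation_topology [simp]: "topspace (valuation_topology X) = valuations X"
  by (simp add: valuation_topology_def valuations_def)

lemma compact_space_valuation_topology: "compact_space (valuation_topology X)"
  by (simp add: valuation_topology_def compact_space_product_topology
      compact_space_discrete_topology ZZ_def)

text \<open>The product of two discrete spaces is discrete, so the pair of \<open>f\<close> and
  \<open>g\<close> is a continuous map into a discrete space, and every function \<open>h\<close>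
  out of such a space is continuous.\<close>

lemma continuous_map_into_discrete_binop:
  assumes "continuous_map T (discrete_topology UNIV) f"
    and "continuous_map T (discrete_topology UNIV) g"
  shows "continuous_map T (discrete_topology UNIV) (\<lambda>x. h (f x) (g x))"
proof -
  have "continuous_map T (discrete_topology UNIV) (\<lambda>x. (f x, g x))"
    using continuous_map_pairedI[OF assms] by (simp flip: prod_topology_discrete_topology)
  then have "continuous_map T (discrete_topology UNIV) (case_prod h \<circ> (\<lambda>x. (f x, g x)))"
    by (rule continuous_map_compose) simp
  then show ?thesis
    by (simp add: comp_def)
qed

text \<open>Induction on the formula: variables are coordinate projections, constants are constant
  maps, and each connective is a binary operation on discrete values. Taking all reals as the
  discrete codomain fits the connectives, which are total functions on the reals, so closure of
  \<open>ZZ\<close> does not enter the induction.\<close>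

lemma continuous_map_val:
  assumes "\<phi> \<in> FORM X"
  shows "continuous_map (valuation_topology X) (discrete_topology UNIV) (val \<phi>)"
  using assms
proof (induction \<phi>)
  case (Var x)
  then have "continuous_map (valuation_topology X) (discrete_topology ZZ) (\<lambda>v. v x)"
    unfolding valuation_topology_def
    by (intro continuous_map_product_projection) (simp add: FORM_def)
  \<comment> \<open>The projection takes values in the discrete space \<open>ZZ\<close>; composing
    with the inclusion enlarges the codomain to all reals.\<close>
  moreover have "continuous_map (discrete_topology ZZ) (discrete_topology UNIV) id"
    by simp
  ultimately have "continuous_map (valuation_topology X) (discrete_topology UNIV) (id \<circ> (\<lambda>v. v x))"
    by (rule continuous_map_compose)
  then show ?case
    by (simp add: comp_def)
next
  case (Join \<phi> \<psi>)
  then show ?case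
    by (simp add: FORM_def val.simps[abs_def]
        continuous_map_into_discrete_binop[where h = zjoin])
next
  case (Partial \<phi> \<psi>)
  then show ?case
    by (simp add: FORM_def val.simps[abs_def]
        continuous_map_into_discrete_binop[where h = zpartial])
next
  case (Conj \<phi> \<psi>)
  then show ?case
    by (simp add: FORM_def val.simps[abs_def]
        continuous_map_into_discrete_binop[where h = min])
qed (simp_all add: val.simps[abs_def])

text \<open>The witness condition is a Boolean function of two continuous discrete values, hence
  itself continuous into the discrete Booleans; the set is its preimage of
  \<open>{True}\<close>.\<close>

lemma openin_witness_set:
  assumes "\<theta> \<in> FORM X" and "\<phi> \<in> FORM X"
  shows "openin (valuation_topology X)
           {v \<in> valuations X. zjoin (val \<theta> v) (val \<phi> v) = val \<phi> v}"
proof -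
  have "continuous_map (valuation_topology X) (discrete_topology UNIV)
          (\<lambda>v. zjoin (val \<theta> v) (val \<phi> v) = val \<phi> v)"
    by (rule continuous_map_into_discrete_binop[where h = "\<lambda>x y. zjoin x y = y"])
      (rule continuous_map_val assms)+
  from openin_continuous_map_preimage[OF this, of "{True}"] show ?thesis
    by simp
qed

text \<open>A clash between two premises, or a witness at a valuation, survives in any larger set.
  If enlarging the set creates a new clash, the larger set entails everything.\<close>

lemma entails_mono:
  assumes "entails X \<Theta>\<^sub>0 \<phi>" and "\<Theta>\<^sub>0 \<subseteq> \<Theta>"
  shows "entails X \<Theta> \<phi>"
  using assms unfolding entails_def incompatible_def by blast

lemma entails_compact:
  assumes "\<Theta> \<subseteq> FORM X" and "\<phi> \<in> FORM X" and "entails X \<Theta> \<phi>"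
  obtains \<Theta>\<^sub>0 where "\<Theta>\<^sub>0 \<subseteq> \<Theta>" "finite \<Theta>\<^sub>0" "entails X \<Theta>\<^sub>0 \<phi>"
proof (cases "incompatible X \<Theta>")
  case True
  then obtain v \<theta>\<^sub>1 \<theta>\<^sub>2 where "v \<in> valuations X" and \<theta>: "\<theta>\<^sub>1 \<in> \<Theta>" "\<theta>\<^sub>2 \<in> \<Theta>"
    and "{val \<theta>\<^sub>1 v, val \<theta>\<^sub>2 v} = {0, 1}"
    unfolding incompatible_def by blast
  \<comment> \<open>Incompatibility is always due to at most two formulas at a single valuation, so
    compactness is called for only in the other case.\<close>
  then have "entails X {\<theta>\<^sub>1, \<theta>\<^sub>2} \<phi>"
    unfolding entails_def incompatible_def by blast
  with \<theta> show thesis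
    by (intro that[of "{\<theta>\<^sub>1, \<theta>\<^sub>2}"]) auto
next
  case False
  define W where "W \<theta> = {v \<in> valuations X. zjoin (val \<theta> v) (val \<phi> v) = val \<phi> v}" for \<theta>
  \<comment> \<open>\<open>Half\<close> must index a set of the cover too, since at some valuations
    it may be the only witness.\<close>
  have "\<Theta> \<union> {Half} \<subseteq> FORM X"
    using assms(1) by (simp add: FORM_def)
  then have "openin (valuation_topology X) (W \<theta>)" if "\<theta> \<in> \<Theta> \<union> {Half}" for \<theta>
    unfolding W_def using openin_witness_set[OF _ assms(2)] that by (meson subsetD)
  then have "\<forall>U \<in> W ` (\<Theta> \<union> {Half}). openin (valuation_topology X) U"
    by blast
  moreover have "topspace (valuation_topology X) \<subseteq> \<Union> (W ` (\<Theta> \<union> {Half}))"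
    using assms(3) False unfolding W_def entails_def by auto
  ultimately obtain \<F> where "finite \<F>" "\<F> \<subseteq> W ` (\<Theta> \<union> {Half})" "valuations X \<subseteq> \<Union> \<F>"
    using compact_space_valuation_topology[of X]
    unfolding compact_space_alt topspace_valuation_topology by meson
  then obtain K where K: "K \<subseteq> \<Theta> \<union> {Half}" "finite K" "valuations X \<subseteq> \<Union> (W ` K)"
    using finite_subset_image by metis
  \<comment> \<open>\<open>K\<close> may contain \<open>Half\<close> although \<Theta> does not.
    Intersecting with \<Theta> loses no witness, because \<open>entails\<close> adds
    \<open>Half\<close> back.\<close>
  then have "entails X (K \<inter> \<Theta>) \<phi>"
    unfolding entails_def W_def by blast
  with K show thesis
    by (intro that[of "K \<inter> \<Theta>"]) auto
qed

theorem theorem5p6: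
  fixes X :: "'x set" and \<Theta> :: "'x form set" and \<phi> :: "'x form"
  assumes "X \<noteq> {}"
    and "\<Theta> \<subseteq> FORM X"
    and "infinite \<Theta>"
    and "\<phi> \<in> FORM X"
  shows "entails X \<Theta> \<phi> \<longleftrightarrow>
         (\<exists>\<Theta>\<^sub>0. \<Theta>\<^sub>0 \<subseteq> \<Theta> \<and> finite \<Theta>\<^sub>0 \<and> \<Theta>\<^sub>0 \<noteq> {} \<and> entails X \<Theta>\<^sub>0 \<phi>)"
proof
  assume "entails X \<Theta> \<phi>"
  with assms obtain \<Theta>\<^sub>0 where \<Theta>\<^sub>0: "\<Theta>\<^sub>0 \<subseteq> \<Theta>" "finite \<Theta>\<^sub>0" "entails X \<Theta>\<^sub>0 \<phi>"
    using entails_compact by metis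
  \<comment> \<open>The finite subset found may be empty, for instance if \<open>Half\<close> alone
    is a witness everywhere; adding any member of the infinite set \<Theta> makes it nonempty, and
    monotonicity keeps the entailment.\<close>
  obtain \<theta> where "\<theta> \<in> \<Theta>"
    using assms(3) by fastforce
  moreover have "entails X (insert \<theta> \<Theta>\<^sub>0) \<phi>"
    using \<Theta>\<^sub>0(3) by (rule entails_mono) blast
  ultimately show "\<exists>\<Theta>\<^sub>0. \<Theta>\<^sub>0 \<subseteq> \<Theta> \<and> finite \<Theta>\<^sub>0 \<and> \<Theta>\<^sub>0 \<noteq> {} \<and> entails X \<Theta>\<^sub>0 \<phi>"
    using \<Theta>\<^sub>0 by (intro exI[of _ "insert \<theta> \<Theta>\<^sub>0"]) auto
qed (blast intro: entails_mono)

end
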